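(* Let $H$ be a (nonempty) perfect graph and let $f:V(H)\to\mathbb{Q}^{+}$ be a weight function assigning a positive rational number to each vertex. Then $$\omega(H)\ \ge\ \left\lceil \frac{f(V(H))}{\alpha_f(H)}\right\rceil .$$
   Context: Graphs are finite and simple. A graph $G$ is perfect if $\chi(G')=\omega(G')$ for every induced subgraph $G'$ of $G$, where $\chi$ is the chromatic number and $\omega$ the clique number. For $A\subseteq V(H)$, $f(A)=\sum_{v\in A}f(v)$. The weighted independence number of $H$ relative to $f$ is $\alpha_f(H)=\max\{f(A): A \text{ is an independent set in } H\}$. *)

theory Defs
  imports Complex_Main "HOL-Library.Ramsey"
begin

text \<open>
  A graph is a pair of a vertex set \<open>V\<close> and a set \<open>E\<close> of two-element subsets of \<open>V\<close>, as in
  \<^theory>\<open>HOL-Library.Ramsey\<close>, whose \<^const>\<open>clique\<close> and \<^const>\<open>indep\<close> are used below.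
\<close>

definition simple_graph :: "'a set \<Rightarrow> 'a set set \<Rightarrow> bool" where
  "simple_graph V E \<longleftrightarrow> finite V \<and> E \<subseteq> [V]\<^bsup>2\<^esup>"

definition induced_edges :: "'a set set \<Rightarrow> 'a set \<Rightarrow> 'a set set" where
  "induced_edges E W = {e \<in> E. e \<subseteq> W}"

definition clique_number :: "'a set \<Rightarrow> 'a set set \<Rightarrow> nat" where
  "clique_number V E = Max {card C | C. C \<subseteq> V \<and> clique C E}"

definition proper_coloring :: "'a set \<Rightarrow> 'a set set \<Rightarrow> nat \<Rightarrow> ('a \<Rightarrow> nat) \<Rightarrow> bool" where
  "proper_coloring V E k c \<longleftrightarrow>
     c \<in> V \<rightarrow> {..<k} \<and> (\<forall>u\<in>V. \<forall>v\<in>V. {u, v} \<in> E \<longrightarrow> c u \<noteq> c v)"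

definition chromatic_number :: "'a set \<Rightarrow> 'a set set \<Rightarrow> nat" where
  "chromatic_number V E = (LEAST k. \<exists>c. proper_coloring V E k c)"

definition perfect_graph :: "'a set \<Rightarrow> 'a set set \<Rightarrow> bool" where
  "perfect_graph V E \<longleftrightarrow> simple_graph V E \<and>
     (\<forall>W\<subseteq>V. chromatic_number W (induced_edges E W) = clique_number W (induced_edges E W))"

definition weighted_independence_number ::
    "'a set \<Rightarrow> 'a set set \<Rightarrow> ('a \<Rightarrow> rat) \<Rightarrow> rat" where
  "weighted_independence_number V E f = Max {sum f A | A. A \<subseteq> V \<and> indep A E}"

end

theory Submission
  imports Defs
begin

text \<open>
  A perfect graph has a proper colouring with as many colours as its clique number. The colour
  classes partition the vertex set into independent sets, each of weight at most the weighted
  independence number.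
\<close>

lemma simple_graph_no_loop:
  assumes "simple_graph V E"
  shows "{v, v} \<notin> E"
  using assms by (auto simp: simple_graph_def nsets_def)

lemma induced_edges_self:
  assumes "simple_graph V E"
  shows "induced_edges E V = E"
  using assms by (auto simp: simple_graph_def induced_edges_def nsets_def)

text \<open>The \<open>LEAST\<close> is attained because some number of colours suffices: an
  injective numbering of the finite set \<open>V\<close> gives distinct colours to the ends of every
  edge, as there are no loops.\<close>

lemma proper_coloring_chromatic_number:
  assumes "simple_graph V E"
  obtains c where "proper_coloring V E (chromatic_number V E) c"
proof -
  have "finite V" using assms by (simp add: simple_graph_def)
  then obtain c :: "'a \<Rightarrow> nat" where c: "bij_betw c V {0..<card V}"
    using ex_bij_betw_finite_nat by blast
  have "c u \<noteq> c v" if "u \<in> V" "v \<in> V" "{u, v} \<in> E" for u v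
    using that c simple_graph_no_loop[OF assms] by (metis bij_betw_imp_inj_on inj_onD)
  then have "\<exists>c. proper_coloring V E (card V) c"
    using bij_betw_apply[OF c] by (intro exI[of _ c]) (auto simp: proper_coloring_def)
  then have "\<exists>c. proper_coloring V E (chromatic_number V E) c"
    unfolding chromatic_number_def by (rule LeastI)
  then show thesis using that by blast
qed

lemma indep_color_class:
  assumes "proper_coloring V E k c"
  shows "indep {v \<in> V. c v = i} E"
  using assms unfolding proper_coloring_def indep_def by (metis (mono_tags, lifting) mem_Collect_eq)

lemma sum_le_weighted_independence_number:
  assumes "finite V" "A \<subseteq> V" "indep A E"
  shows "sum f A \<le> weighted_independence_number V E f"
proof -
  \<comment> \<open>\<open>Max\<close> bounds the members of a set only if the set is finite; here
    finiteness comes from that of \<open>Pow V\<close>.\<close>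
  have "{sum f A | A. A \<subseteq> V \<and> indep A E} \<subseteq> sum f ` Pow V" by auto
  then have "finite {sum f A | A. A \<subseteq> V \<and> indep A E}"
    using assms(1) by (meson finite_Pow_iff finite_imageI finite_subset)
  then show ?thesis
    unfolding weighted_independence_number_def using assms(2,3) by (intro Max_ge) auto
qed

lemma sum_le_colors_times_weighted_independence_number:
  assumes "finite V" "proper_coloring V E k c"
  shows "sum f V \<le> of_nat k * weighted_independence_number V E f"
proof -
  have "c ` V \<subseteq> {..<k}" using assms(2) by (auto simp: proper_coloring_def)
  then have "sum f V = (\<Sum>i<k. sum f {v \<in> V. c v = i})"
    using sum.group[OF assms(1), of "{..<k}" c f] by simp
  also have "\<dots> \<le> (\<Sum>i<k. weighted_independence_number V E f)"
    using assms(1) indep_color_class[OF assms(2)]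
    by (intro sum_mono sum_le_weighted_independence_number) auto
  finally show ?thesis by simp
qed

theorem theorem3:
  fixes V :: "'a set" and E :: "'a set set" and f :: "'a \<Rightarrow> rat"
  assumes "perfect_graph V E"
    and "V \<noteq> {}"
    and "\<And>v. v \<in> V \<Longrightarrow> f v > 0"
  shows "int (clique_number V E) \<ge> \<lceil>sum f V / weighted_independence_number V E f\<rceil>"
proof -
  have G: "simple_graph V E" and fin: "finite V"
    using assms(1) by (auto simp: perfect_graph_def simple_graph_def)
  \<comment> \<open>Perfection is applied to the whole graph, as the subgraph induced by
    \<open>V\<close> itself.\<close>
  have "chromatic_number V E = clique_number V E"
    using assms(1) induced_edges_self[OF G] by (metis perfect_graph_def subset_refl)
  then obtain c where "proper_coloring V E (clique_number V E) c"
    using proper_coloring_chromatic_number[OF G] by metis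
  then have le: "sum f V \<le> of_nat (clique_number V E) * weighted_independence_number V E f"
    using sum_le_colors_times_weighted_independence_number fin by blast
  \<comment> \<open>Division needs a positive denominator: a single vertex is an independent set of
    positive weight.\<close>
  obtain v where v: "v \<in> V" using assms(2) by blast
  have "indep {v} E"
    using simple_graph_no_loop[OF G] by (simp add: indep_def)
  then have "f v \<le> weighted_independence_number V E f"
    using sum_le_weighted_independence_number[OF fin, of "{v}" E f] v by simp
  then have "weighted_independence_number V E f > 0"
    using assms(3)[OF v] by linarith
  then have "sum f V / weighted_independence_number V E f \<le> of_nat (clique_number V E)"
    using le by (simp add: pos_divide_le_eq)
  \<comment> \<open>The upper bound is an integer, so it also bounds the ceiling.\<close>
  then show ?thesis by (simp add: ceiling_le_iff)
qed

end
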